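(* Let $T>0$, $\gamma_1\gamma_2>0$, $u_0\in H^1$, $v_0\in H^1_{\mathbb R}$, $\Phi_1\in\mathcal L_2(H_{\mathbb R};H^1)$, $\Phi_2\in\mathcal L_2(H_{\mathbb R};H^1_{\mathbb R})$, and let $(u,v)$ be the solution of the stochastic Schrödinger--KdV equation described in the context. Then for all $t\in[0,T]$, $$\mathbb E\Big[\int_{\mathcal O}v(t,x)\,dx\Big]=\mathbb E\Big[\int_{\mathcal O}v_0(x)\,dx\Big].$$
   Context: $\mathcal O=(0,L)$ with periodic boundary conditions; $\mathbf i=\sqrt{-1}$; $\gamma_1,\gamma_2,\beta\in\mathbb R$. $H=L^2(\mathcal O;\mathbb C)$, $H_{\mathbb R}=L^2(\mathcal O;\mathbb R)$, $H^m=H^m(\mathcal O;\mathbb C)$, $H^m_{\mathbb R}=H^m(\mathcal O;\mathbb R)$, and $\mathcal L_2(U_1;U_2)$ denotes the Hilbert--Schmidt operators from $U_1$ to $U_2$. $W_1,W_2$ are independent cylindrical Wiener processes on $H_{\mathbb R}$: $W_k(t)=\sum_{i=1}^\infty\beta_k^{(i)}(t)e_k^{(i)}$ with independent real standard Brownian motions $\beta_k^{(i)}$ and orthonormal bases $\{e_k^{(i)}\}_{i}$ of $H_{\mathbb R}$, $k=1,2$. The stochastic Schrödinger--KdV equation is $$du=\big(\mathbf i\partial_x^2u-\mathbf i(\gamma_1v+\beta|u|^2)u\big)dt+\Phi_1\,dW_1(t),\qquad dv=\big(-\partial_x^3v+\gamma_2\partial_x|u|^2-v\partial_xv\big)dt+\Phi_2\,dW_2(t),$$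 with $(u(0),v(0))=(u_0,v_0)$, $u$ complex-valued, $v$ real-valued, and periodic boundary conditions ($u,u_x,v,v_x,v_{xx}$ agree at $x=0$ and $x=L$). Under the stated hypotheses it has a unique strong solution $(u,v)\in L^2(\Omega;C([0,T];H^1\times H^1))$; this is the solution meant. *)

theory Defs
  imports "HOL-Probability.Probability"
begin

section \<open>Periodic function spaces on \<open>(0, L)\<close>\<close>

text \<open>
  Elements of \<open>L\<^sup>2\<close> and \<open>H\<^sup>1\<close> are given by Borel representatives on \<open>(0, L)\<close>; equality of elements is
  equality almost everywhere. All definitions below depend on the representative only through its
  class. The codomain \<open>'a\<close> is \<^typ>\<open>real\<close> for \<open>H\<^sub>\<real>\<close>, \<open>H\<^sup>1\<^sub>\<real>\<close>
  and \<^typ>\<open>complex\<close> for \<open>H\<close>, \<open>H\<^sup>1\<close>.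
\<close>

definition domain_measure :: "real \<Rightarrow> real measure" where
  "domain_measure L = restrict_space lborel {0<..<L}"

definition L2 :: "real \<Rightarrow> (real \<Rightarrow> 'a::{banach, second_countable_topology}) set" where
  "L2 L = {f \<in> borel_measurable (domain_measure L).
             integrable (domain_measure L) (\<lambda>x. (norm (f x))\<^sup>2)}"

definition L2norm :: "real \<Rightarrow> (real \<Rightarrow> 'a::{banach, second_countable_topology}) \<Rightarrow> real" where
  "L2norm L f = sqrt (\<integral>x. (norm (f x))\<^sup>2 \<partial>domain_measure L)"

definition L2inner :: "real \<Rightarrow> (real \<Rightarrow> real) \<Rightarrow> (real \<Rightarrow> real) \<Rightarrow> real" where
  "L2inner L f g = (\<integral>x. f x * g x \<partial>domain_measure L)"

text \<open>
  Periodic distributions act on smooth \<open>L\<close>-periodic real test functions. Since the test functions are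
  periodic rather than compactly supported in \<open>(0, L)\<close>, the distributional derivative carries the
  periodic boundary conditions: a function with jump \<open>f(0+) \<noteq> f(L-)\<close> has no weak derivative in \<open>L\<^sup>2\<close>.
\<close>

definition test_functions :: "real \<Rightarrow> (real \<Rightarrow> real) set" where
  "test_functions L = {\<phi>. (\<forall>n x. (deriv ^^ n) \<phi> field_differentiable at x) \<and> (\<forall>x. \<phi> (x + L) = \<phi> x)}"

type_synonym 'a distribution = "(real \<Rightarrow> real) \<Rightarrow> 'a"

definition regular_distribution ::
    "real \<Rightarrow> (real \<Rightarrow> 'a::{banach, second_countable_topology}) \<Rightarrow> 'a distribution" where
  "regular_distribution L f \<phi> = (\<integral>x. \<phi> x *\<^sub>R f x \<partial>domain_measure L)"

definition ddx :: "'a::real_vector distribution \<Rightarrow> 'a distribution" where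
  "ddx S \<phi> = - S (deriv \<phi>)"

definition weak_derivative ::
    "real \<Rightarrow> (real \<Rightarrow> 'a::{banach, second_countable_topology}) \<Rightarrow> (real \<Rightarrow> 'a) \<Rightarrow> bool" where
  "weak_derivative L f g \<longleftrightarrow>
     (\<forall>\<phi>\<in>test_functions L. ddx (regular_distribution L f) \<phi> = regular_distribution L g \<phi>)"

definition H1 :: "real \<Rightarrow> (real \<Rightarrow> 'a::{banach, second_countable_topology}) set" where
  "H1 L = {f \<in> L2 L. \<exists>g\<in>L2 L. weak_derivative L f g}"

text \<open>For \<open>f\<close> in \<open>H\<^sup>1\<close>, the weak derivative is determined up to a null set.\<close>

definition wderiv ::
    "real \<Rightarrow> (real \<Rightarrow> 'a::{banach, second_countable_topology}) \<Rightarrow> real \<Rightarrow> 'a" where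
  "wderiv L f = (SOME g. g \<in> L2 L \<and> weak_derivative L f g)"

definition H1norm :: "real \<Rightarrow> (real \<Rightarrow> 'a::{banach, second_countable_topology}) \<Rightarrow> real" where
  "H1norm L f = sqrt ((L2norm L f)\<^sup>2 + (L2norm L (wderiv L f))\<^sup>2)"

definition H1_open :: "real \<Rightarrow> (real \<Rightarrow> 'a::{banach, second_countable_topology}) set \<Rightarrow> bool" where
  "H1_open L U \<longleftrightarrow> U \<subseteq> H1 L \<and>
     (\<forall>f\<in>U. \<exists>\<epsilon>>0. \<forall>g\<in>H1 L. H1norm L (\<lambda>x. g x - f x) < \<epsilon> \<longrightarrow> g \<in> U)"

definition H1_borel :: "real \<Rightarrow> (real \<Rightarrow> 'a::{banach, second_countable_topology}) measure" where
  "H1_borel L = sigma (H1 L) {U. H1_open L U}"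

section \<open>Hilbert--Schmidt operators and Wiener processes\<close>

definition orthonormal_basis :: "real \<Rightarrow> (nat \<Rightarrow> real \<Rightarrow> real) \<Rightarrow> bool" where
  "orthonormal_basis L e \<longleftrightarrow>
     (\<forall>i. e i \<in> L2 L) \<and>
     (\<forall>i j. L2inner L (e i) (e j) = (if i = j then 1 else 0)) \<and>
     (\<forall>f\<in>L2 L. (\<lambda>n. L2norm L (\<lambda>x. f x - (\<Sum>i<n. L2inner L f (e i) * e i x))) \<longlonglongrightarrow> 0)"

text \<open>The Hilbert--Schmidt sum does not depend on the choice of the basis.\<close>

definition hilbert_schmidt ::
    "real \<Rightarrow> ((real \<Rightarrow> real) \<Rightarrow> real \<Rightarrow> 'a::{banach, second_countable_topology}) \<Rightarrow> bool" where
  "hilbert_schmidt L \<Phi> \<longleftrightarrow>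
     (\<forall>f\<in>L2 L. \<Phi> f \<in> H1 L) \<and>
     (\<forall>f\<in>L2 L. \<forall>g\<in>L2 L. \<forall>a b. AE x in domain_measure L.
        \<Phi> (\<lambda>y. a * f y + b * g y) x = a *\<^sub>R \<Phi> f x + b *\<^sub>R \<Phi> g x) \<and>
     (\<exists>C. \<forall>f\<in>L2 L. H1norm L (\<Phi> f) \<le> C * L2norm L f) \<and>
     (\<exists>e. orthonormal_basis L e \<and> summable (\<lambda>i. (H1norm L (\<Phi> (e i)))\<^sup>2))"

text \<open>A filtration \<open>F\<close> of sub-\<open>\<sigma>\<close>-algebras of \<open>M\<close>; only the times \<open>t \<ge> 0\<close> are relevant.\<close>

definition filtered_prob_space :: "'w measure \<Rightarrow> (real \<Rightarrow> 'w measure) \<Rightarrow> bool" where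
  "filtered_prob_space M F \<longleftrightarrow>
     prob_space M \<and> filtration (space M) F \<and> (\<forall>t. subalgebra M (F t))"

definition brownian_motion ::
    "'w measure \<Rightarrow> (real \<Rightarrow> 'w measure) \<Rightarrow> (real \<Rightarrow> 'w \<Rightarrow> real) \<Rightarrow> bool" where
  "brownian_motion M F B \<longleftrightarrow>
     (AE \<omega> in M. B 0 \<omega> = 0) \<and>
     (AE \<omega> in M. continuous_on {0..} (\<lambda>t. B t \<omega>)) \<and>
     (\<forall>t\<ge>0. B t \<in> borel_measurable (F t)) \<and>
     (\<forall>s t. 0 \<le> s \<longrightarrow> s < t \<longrightarrow>
        distributed M lborel (\<lambda>\<omega>. B t \<omega> - B s \<omega>) (normal_density 0 (sqrt (t - s))) \<and>
        prob_space.indep_set M (sets (F s))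
          {(\<lambda>\<omega>. B t \<omega> - B s \<omega>) -` A \<inter> space M | A. A \<in> sets borel})"

text \<open>
  The two cylindrical Wiener processes \<open>W\<^sub>k = \<Sum>\<^sub>i \<beta>\<^sub>k\<^sup>(\<^sup>i\<^sup>) e\<^sub>k\<^sup>(\<^sup>i\<^sup>)\<close> are represented by their coordinate processes
  and bases; all coordinate processes of both are jointly independent.
\<close>

definition independent_cylindrical_wiener ::
    "'w measure \<Rightarrow> (real \<Rightarrow> 'w measure) \<Rightarrow> real
      \<Rightarrow> (nat \<Rightarrow> real \<Rightarrow> 'w \<Rightarrow> real) \<Rightarrow> (nat \<Rightarrow> real \<Rightarrow> real)
      \<Rightarrow> (nat \<Rightarrow> real \<Rightarrow> 'w \<Rightarrow> real) \<Rightarrow> (nat \<Rightarrow> real \<Rightarrow> real) \<Rightarrow> bool" where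
  "independent_cylindrical_wiener M F L b1 e1 b2 e2 \<longleftrightarrow>
     orthonormal_basis L e1 \<and> orthonormal_basis L e2 \<and>
     (\<forall>i. brownian_motion M F (b1 i)) \<and> (\<forall>i. brownian_motion M F (b2 i)) \<and>
     prob_space.indep_vars M (\<lambda>_. PiM {0..} (\<lambda>_. borel))
       (\<lambda>j \<omega>. \<lambda>t\<in>{0..}. case_sum b1 b2 j t \<omega>) (UNIV :: (nat + nat) set)"

text \<open>
  \<open>Z\<close> is (a version of) \<open>\<integral>\<^sub>0\<^sup>t \<Phi> dW = \<Sum>\<^sub>i \<beta>\<^sup>(\<^sup>i\<^sup>)(t) \<Phi> e\<^sup>(\<^sup>i\<^sup>)\<close>, the series converging in \<open>L\<^sup>2(\<Omega>; H\<^sup>1)\<close>. As the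
  integrand \<open>\<Phi>\<close> is constant, this is the Ito integral.
\<close>

definition wiener_integral ::
    "'w measure \<Rightarrow> real \<Rightarrow> (nat \<Rightarrow> real \<Rightarrow> 'w \<Rightarrow> real) \<Rightarrow> (nat \<Rightarrow> real \<Rightarrow> real)
      \<Rightarrow> ((real \<Rightarrow> real) \<Rightarrow> real \<Rightarrow> 'a::{banach, second_countable_topology}) \<Rightarrow> real
      \<Rightarrow> ('w \<Rightarrow> real \<Rightarrow> 'a) \<Rightarrow> bool" where
  "wiener_integral M L b e \<Phi> t Z \<longleftrightarrow>
     Z \<in> measurable M (H1_borel L) \<and>
     (\<lambda>n. \<integral>\<^sup>+\<omega>. ennreal ((H1norm L (\<lambda>x. Z \<omega> x - (\<Sum>i<n. b i t \<omega> *\<^sub>R \<Phi> (e i) x)))\<^sup>2) \<partial>M) \<longlonglongrightarrow> 0"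

section \<open>The stochastic Schroedinger--KdV equation\<close>

text \<open>
  The drift terms, as periodic distributions. The product \<open>v \<partial>\<^sub>x v\<close> is a product of functions, with
  \<open>\<partial>\<^sub>x v\<close> the weak derivative of \<open>v\<close>; the other derivatives are distributional.
\<close>

definition schrodinger_drift ::
    "real \<Rightarrow> real \<Rightarrow> real \<Rightarrow> (real \<Rightarrow> complex) \<Rightarrow> (real \<Rightarrow> real) \<Rightarrow> complex distribution" where
  "schrodinger_drift L \<gamma>1 \<beta> u v \<phi> =
     \<i> * ddx (ddx (regular_distribution L u)) \<phi>
     - \<i> * regular_distribution L (\<lambda>x. complex_of_real (\<gamma>1 * v x + \<beta> * (cmod (u x))\<^sup>2) * u x) \<phi>"

definition kdv_drift ::
    "real \<Rightarrow> real \<Rightarrow> (real \<Rightarrow> complex) \<Rightarrow> (real \<Rightarrow> real) \<Rightarrow> real distribution" where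
  "kdv_drift L \<gamma>2 u v \<phi> =
     - ddx (ddx (ddx (regular_distribution L v))) \<phi>
     + \<gamma>2 * ddx (regular_distribution L (\<lambda>x. (cmod (u x))\<^sup>2)) \<phi>
     - regular_distribution L (\<lambda>x. v x * wderiv L v x) \<phi>"

text \<open>Adapted \<open>H\<^sup>1\<close>-valued process on \<open>[0, T]\<close> with almost surely continuous paths in \<open>H\<^sup>1\<close>.\<close>

definition continuous_adapted_H1 ::
    "'w measure \<Rightarrow> (real \<Rightarrow> 'w measure) \<Rightarrow> real \<Rightarrow> real
      \<Rightarrow> (real \<Rightarrow> 'w \<Rightarrow> real \<Rightarrow> 'a::{banach, second_countable_topology}) \<Rightarrow> bool" where
  "continuous_adapted_H1 M F L T X \<longleftrightarrow>
     (\<forall>t\<in>{0..T}. X t \<in> measurable (F t) (H1_borel L)) \<and>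
     (AE \<omega> in M. \<forall>t\<in>{0..T}.
        ((\<lambda>s. H1norm L (\<lambda>x. X s \<omega> x - X t \<omega> x)) \<longlongrightarrow> 0) (at t within {0..T}))"

text \<open>
  Solution in \<open>L\<^sup>2(\<Omega>; C([0,T]; H\<^sup>1 \<times> H\<^sup>1))\<close>, strong in the probabilistic sense: the noise and the filtration
  are given. The integrated equation holds almost surely at every time, as an equality of periodic
  distributions (the drift takes values in spaces of negative order).
\<close>

definition skdv_solution ::
    "'w measure \<Rightarrow> (real \<Rightarrow> 'w measure) \<Rightarrow> real \<Rightarrow> real \<Rightarrow> real \<Rightarrow> real \<Rightarrow> real
      \<Rightarrow> (nat \<Rightarrow> real \<Rightarrow> 'w \<Rightarrow> real) \<Rightarrow> (nat \<Rightarrow> real \<Rightarrow> real)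
      \<Rightarrow> (nat \<Rightarrow> real \<Rightarrow> 'w \<Rightarrow> real) \<Rightarrow> (nat \<Rightarrow> real \<Rightarrow> real)
      \<Rightarrow> ((real \<Rightarrow> real) \<Rightarrow> real \<Rightarrow> complex) \<Rightarrow> ((real \<Rightarrow> real) \<Rightarrow> real \<Rightarrow> real)
      \<Rightarrow> (real \<Rightarrow> complex) \<Rightarrow> (real \<Rightarrow> real)
      \<Rightarrow> (real \<Rightarrow> 'w \<Rightarrow> real \<Rightarrow> complex) \<Rightarrow> (real \<Rightarrow> 'w \<Rightarrow> real \<Rightarrow> real) \<Rightarrow> bool" where
  "skdv_solution M F L T \<gamma>1 \<gamma>2 \<beta> b1 e1 b2 e2 \<Phi>1 \<Phi>2 u0 v0 u v \<longleftrightarrow>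
     continuous_adapted_H1 M F L T u \<and>
     continuous_adapted_H1 M F L T v \<and>
     (\<integral>\<^sup>+\<omega>. (SUP t\<in>{0..T}. ennreal ((H1norm L (u t \<omega>))\<^sup>2 + (H1norm L (v t \<omega>))\<^sup>2)) \<partial>M) < \<infinity> \<and>
     (\<forall>t\<in>{0..T}. \<exists>Z. wiener_integral M L b1 e1 \<Phi>1 t Z \<and>
        (AE \<omega> in M. \<forall>\<phi>\<in>test_functions L.
           regular_distribution L (u t \<omega>) \<phi> =
             regular_distribution L u0 \<phi>
             + (LINT s:{0..t}|lborel. schrodinger_drift L \<gamma>1 \<beta> (u s \<omega>) (v s \<omega>) \<phi>)
             + regular_distribution L (Z \<omega>) \<phi>)) \<and>
     (\<forall>t\<in>{0..T}. \<exists>Z. wiener_integral M L b2 e2 \<Phi>2 t Z \<and>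
        (AE \<omega> in M. \<forall>\<phi>\<in>test_functions L.
           regular_distribution L (v t \<omega>) \<phi> =
             regular_distribution L v0 \<phi>
             + (LINT s:{0..t}|lborel. kdv_drift L \<gamma>2 (u s \<omega>) (v s \<omega>) \<phi>)
             + regular_distribution L (Z \<omega>) \<phi>))"

end

theory Submission
  imports Defs
begin

text \<open>
  Integrate the second equation over a period, that is, test it against the constant function $1$.
  The terms \<open>- \<partial>\<^sub>x\<^sup>3 v\<close> and \<open>\<gamma>\<^sub>2 \<partial>\<^sub>x \<bar>u\<bar>\<^sup>2\<close> are derivatives of periodic distributions and vanish; the
  transport term vanishes because \<open>v \<partial>\<^sub>x v\<close> is the derivative of the periodic function \<open>v\<^sup>2 / 2\<close>. Hence,
  almost surely,
  \<open>\<integral> v(t) dx = \<integral> v\<^sub>0 dx + \<integral> Z dx\<close>, where \<open>Z\<close> is the stochastic integral up to time \<open>t\<close>, and it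
  remains to see that the last term has expectation zero.

  For the transport term (\<open>integral_mult_wderiv_zero\<close>) the weak derivative has to be tied to an honest
  primitive. Trigonometric polynomials are uniformly dense in the continuous periodic functions by
  Stone--Weierstrass on the circle, so an integrable function orthogonal to all test functions vanishes
  (\<open>orthogonal_test_functions_AE_zero\<close>). Since the test functions of mean zero are the derivatives of
  test functions, a function whose weak derivative is zero is constant
  (\<open>du_Bois_Reymond_periodic\<close>), and every $v$ in $H^1$ is a constant plus the primitive of its weak
  derivative (\<open>weak_derivative_primitive\<close>). The claim is then Fubini on a triangle.

  For the noise (\<open>wiener_integral_mean_zero\<close>), the spatial mean is a continuous linear functional on
  $H^1$. It is therefore Borel measurable there (\<open>integral_H1_borel_measurable\<close>), and it maps the
  series of the stochastic integral, which converges in mean square, to a mean-square convergent series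
  of real multiples of Brownian motions, each of mean zero.
\<close>

section \<open>The interval and its square-integrable functions\<close>

lemma integral_domain_measure:
  fixes f :: "real \<Rightarrow> 'a::{banach, second_countable_topology}"
  shows "integral\<^sup>L (domain_measure L) f = (LINT x:{0<..<L}|lborel. f x)"
  unfolding domain_measure_def set_lebesgue_integral_def by (rule integral_restrict_space) simp

lemma finite_measure_domain_measure: "finite_measure (domain_measure L)"
proof (rule finite_measureI)
  have "emeasure lborel {0<..<L} \<noteq> \<infinity>" by (cases "0 \<le> L") auto
  then show "emeasure (domain_measure L) (space (domain_measure L)) \<noteq> \<infinity>"
    by (simp add: domain_measure_def space_restrict_space emeasure_restrict_space)
qed

lemma measure_space_domain_measure: "L > 0 \<Longrightarrow> measure (domain_measure L) (space (domain_measure L)) = L"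
  by (simp add: domain_measure_def space_restrict_space measure_restrict_space)

lemma space_domain_measure [simp]: "space (domain_measure L) = {0<..<L}"
  by (simp add: domain_measure_def space_restrict_space)

lemma borel_measurable_domain_measure:
  "f \<in> borel_measurable borel \<Longrightarrow> f \<in> borel_measurable (domain_measure L)"
  by (simp add: domain_measure_def measurable_restrict_space1)

lemma id_measurable_domain_measure: "(\<lambda>x. x) \<in> domain_measure L \<rightarrow>\<^sub>M borel"
  unfolding domain_measure_def by (rule measurable_restrict_space1) simp

lemma L2_measurable: "f \<in> L2 L \<Longrightarrow> f \<in> borel_measurable (domain_measure L)"
  by (simp add: L2_def)

lemma L2_square_integrable:
  fixes f :: "real \<Rightarrow> real"
  shows "f \<in> L2 L \<Longrightarrow> integrable (domain_measure L) (\<lambda>x. (f x)\<^sup>2)"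
  by (simp add: L2_def)

lemma L2_integrable:
  fixes f :: "real \<Rightarrow> real"
  assumes "f \<in> L2 L" shows "integrable (domain_measure L) f"
  by (rule finite_measure.square_integrable_imp_integrable[OF finite_measure_domain_measure
        L2_measurable[OF assms] L2_square_integrable[OF assms]])

lemma L2_integrable_mult:
  fixes f g :: "real \<Rightarrow> real"
  assumes "f \<in> L2 L" "g \<in> L2 L" shows "integrable (domain_measure L) (\<lambda>x. f x * g x)"
proof (rule Bochner_Integration.integrable_bound)
  show "integrable (domain_measure L) (\<lambda>x. (f x)\<^sup>2 + (g x)\<^sup>2)"
    using assms by (auto simp: L2_def)
  have "\<bar>a * b\<bar> \<le> a\<^sup>2 + b\<^sup>2" for a b :: real
  proof -
    have "2 * \<bar>a\<bar> * \<bar>b\<bar> \<le> \<bar>a\<bar>\<^sup>2 + \<bar>b\<bar>\<^sup>2" by (rule sum_squares_bound)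
    moreover have "0 \<le> \<bar>a\<bar> * \<bar>b\<bar>" by simp
    ultimately show ?thesis unfolding abs_mult power2_abs by linarith
  qed
  then show "AE x in domain_measure L. norm (f x * g x) \<le> norm ((f x)\<^sup>2 + (g x)\<^sup>2)"
    by simp
qed (use assms in \<open>auto simp: L2_def\<close>)

lemma L2_add:
  fixes f g :: "real \<Rightarrow> real"
  assumes "f \<in> L2 L" "g \<in> L2 L" shows "(\<lambda>x. f x + g x) \<in> L2 L"
proof -
  have "integrable (domain_measure L) (\<lambda>x. (f x)\<^sup>2 + 2 * (f x * g x) + (g x)\<^sup>2)"
    using assms L2_integrable_mult[OF assms] by (auto simp: L2_def)
  then show ?thesis using assms by (auto simp: L2_def power2_sum algebra_simps)
qed

lemma L2_scale:
  fixes f :: "real \<Rightarrow> real"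
  assumes "f \<in> L2 L" shows "(\<lambda>x. a * f x) \<in> L2 L"
  using assms by (auto simp: L2_def power_mult_distrib)

lemma L2_diff:
  fixes f g :: "real \<Rightarrow> real"
  assumes "f \<in> L2 L" "g \<in> L2 L" shows "(\<lambda>x. f x - g x) \<in> L2 L"
  using L2_add[OF assms(1) L2_scale[OF assms(2), of "-1"]] by simp

lemma L2_sum:
  fixes f :: "'i \<Rightarrow> real \<Rightarrow> real"
  assumes "\<And>i. i \<in> I \<Longrightarrow> f i \<in> L2 L" shows "(\<lambda>x. \<Sum>i\<in>I. f i x) \<in> L2 L"
  using assms
proof (induction I rule: infinite_finite_induct)
  case (insert i I) then show ?case by (simp add: L2_add)
qed (auto simp: L2_def)

text \<open>
  Cauchy--Schwarz against the constant $1$, read off from the nonnegativity of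
  \<open>\<integral> (f - m / L)\<^sup>2\<close> with \<open>m = \<integral> f\<close>.
\<close>

lemma abs_integral_le_L2norm:
  fixes f :: "real \<Rightarrow> real"
  assumes L: "L > 0" and f: "f \<in> L2 L"
  shows "\<bar>integral\<^sup>L (domain_measure L) f\<bar> \<le> sqrt L * L2norm L f"
proof -
  let ?D = "domain_measure L"
  define m where "m = integral\<^sup>L ?D f"
  interpret finite_measure ?D by (rule finite_measure_domain_measure)
  have i2: "integrable ?D (\<lambda>x. (f x)\<^sup>2)" using f by (simp add: L2_def)
  note i1 = L2_integrable[OF f]
  have "0 \<le> (\<integral>x. (f x - m / L)\<^sup>2 \<partial>?D)" by simp
  also have "\<dots> = (\<integral>x. (f x)\<^sup>2 + ((- 2 * m / L) * f x + (m / L)\<^sup>2) \<partial>?D)"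
    by (simp add: power2_diff algebra_simps)
  also have "\<dots> = (\<integral>x. (f x)\<^sup>2 \<partial>?D) + ((- 2 * m / L) * m + L * (m / L)\<^sup>2)"
    using i1 i2 measure_space_domain_measure[OF L] by (simp add: m_def)
  also have "\<dots> = (\<integral>x. (f x)\<^sup>2 \<partial>?D) - m\<^sup>2 / L"
    using L by (simp add: field_simps power2_eq_square)
  finally have "m\<^sup>2 \<le> L * (\<integral>x. (f x)\<^sup>2 \<partial>?D)"
    using L by (simp add: field_simps)
  then have "sqrt (m\<^sup>2) \<le> sqrt (L * (\<integral>x. (f x)\<^sup>2 \<partial>?D))" by (rule real_sqrt_le_mono)
  then show ?thesis by (simp add: m_def L2norm_def real_sqrt_mult)
qed

lemma L2norm_le_H1norm: "L2norm L f \<le> H1norm L f"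
  unfolding H1norm_def by (rule real_sqrt_sum_squares_ge1)

section \<open>Smooth periodic test functions\<close>

text \<open>
  The left end point is a parameter because this evaluates the sections \<open>x > y\<close> of the triangle in the
  integration by parts below.
\<close>

lemma integral_domain_measure_FTC:
  fixes f F :: "real \<Rightarrow> real"
  assumes F: "\<And>x. (F has_real_derivative f x) (at x)" and f: "continuous_on UNIV f"
    and a: "0 \<le> a" "a \<le> L"
  shows "(\<integral>x. f x * indicator {a<..} x \<partial>domain_measure L) = F L - F a"
proof -
  have "(\<integral>x. f x * indicator {a<..} x \<partial>domain_measure L) =
     (\<integral>x. indicator {0<..<L} x *\<^sub>R (f x * indicator {a<..} x) \<partial>lborel)"
    by (simp add: integral_domain_measure set_lebesgue_integral_def)
  also have "\<dots> = (\<integral>x. f x * indicator {a..L} x \<partial>lborel)"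
  proof (rule integral_cong_AE)
    have "AE x in lborel. x \<noteq> a" "AE x in lborel. x \<noteq> L" by (rule AE_lborel_singleton)+
    then show "AE x in lborel. indicator {0<..<L} x *\<^sub>R (f x * indicator {a<..} x) = f x * indicator {a..L} x"
      by eventually_elim (use a in \<open>auto simp: indicator_def\<close>)
    have "f \<in> borel_measurable borel" by (rule borel_measurable_continuous_onI[OF f])
    then show "(\<lambda>x. indicator {0<..<L} x *\<^sub>R (f x * indicator {a<..} x)) \<in> borel_measurable lborel"
      "(\<lambda>x. f x * indicator {a..L} x) \<in> borel_measurable lborel"
      by simp_all
  qed
  also have "\<dots> = F L - F a"
    using f a by (intro integral_FTC_Icc_real F) (auto simp: continuous_on_eq_continuous_at)
  finally show ?thesis .
qed

lemma test_functions_DERIV: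
  assumes "\<phi> \<in> test_functions L" shows "(\<phi> has_real_derivative deriv \<phi> x) (at x)"
proof -
  have "(deriv ^^ 0) \<phi> field_differentiable at x" using assms unfolding test_functions_def by blast
  then show ?thesis by (simp add: DERIV_deriv_iff_field_differentiable)
qed

lemma test_functions_continuous: "\<phi> \<in> test_functions L \<Longrightarrow> continuous_on UNIV \<phi>"
  by (intro continuous_at_imp_continuous_on ballI DERIV_isCont[OF test_functions_DERIV])

lemma continuous_deriv_test_functions:
  assumes "\<phi> \<in> test_functions L" shows "continuous_on UNIV (deriv \<phi>)"
proof -
  have "(deriv ^^ 1) \<phi> field_differentiable at x" for x
    using assms unfolding test_functions_def by blast
  then show ?thesis
    by (auto intro!: continuous_at_imp_continuous_on field_differentiable_imp_continuous_at)
qed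

lemma const_test_function: "(\<lambda>_. c) \<in> test_functions L"
proof -
  have "(deriv ^^ n) (\<lambda>_::real. c) = (\<lambda>_. if n = 0 then c else 0)" for n
    by (induction n) auto
  then show ?thesis by (simp add: test_functions_def)
qed

text \<open>
  The integral of \<open>\<psi>\<close> is the increment over a period of any of its primitives, so it is exactly the
  obstruction to having a periodic one.
\<close>

lemma test_function_primitive:
  assumes L: "L > 0" and \<psi>: "\<psi> \<in> test_functions L" and mean: "integral\<^sup>L (domain_measure L) \<psi> = 0"
  obtains \<Psi> where "\<Psi> \<in> test_functions L" "deriv \<Psi> = \<psi>"
proof -
  have "\<exists>\<Psi>. \<forall>x::real. -\<infinity> < ereal x \<longrightarrow> ereal x < \<infinity> \<longrightarrow> (\<Psi> has_vector_derivative \<psi> x) (at x)"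
    using test_functions_continuous[OF \<psi>]
    by (intro einterval_antiderivative) (auto simp: continuous_on_eq_continuous_at)
  then obtain \<Psi> where \<Psi>: "\<And>x. (\<Psi> has_real_derivative \<psi> x) (at x)"
    by (auto simp: has_real_derivative_iff_has_vector_derivative)
  have d: "deriv \<Psi> = \<psi>" using \<Psi> DERIV_imp_deriv by blast
  have "integral\<^sup>L (domain_measure L) \<psi> = (\<integral>x. \<psi> x * indicator {0<..} x \<partial>domain_measure L)"
    by (rule Bochner_Integration.integral_cong) auto
  also have "\<dots> = \<Psi> L - \<Psi> 0"
    using L by (intro integral_domain_measure_FTC \<Psi> test_functions_continuous[OF \<psi>]) auto
  finally have 0: "\<Psi> L = \<Psi> 0" using mean by simp
  have per: "\<psi> (x + L) = \<psi> x" for x using \<psi> by (simp add: test_functions_def)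
  have "((\<lambda>x. \<Psi> (x + L) - \<Psi> x) has_real_derivative 0) (at x)" for x
    by (rule derivative_eq_intros DERIV_chain2[where g="\<lambda>x. x + L", OF \<Psi>] \<Psi> refl)+ (simp add: per)
  then have "\<Psi> (x + L) - \<Psi> x = \<Psi> (0 + L) - \<Psi> 0" for x
    by (intro DERIV_isconst_all[rule_format, where f="\<lambda>x. \<Psi> (x + L) - \<Psi> x"]) auto
  then have "\<Psi> (x + L) = \<Psi> x" for x using 0 by simp
  moreover have "(deriv ^^ n) \<Psi> field_differentiable at x" for n x
  proof (cases n)
    case 0 then show ?thesis using \<Psi> by (auto simp: field_differentiable_def)
  next
    case (Suc m)
    then have "(deriv ^^ n) \<Psi> = (deriv ^^ m) \<psi>" by (simp add: funpow_Suc_right d del: funpow.simps)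
    then show ?thesis using \<psi> by (simp add: test_functions_def)
  qed
  ultimately show ?thesis using d that by (auto simp: test_functions_def)
qed

text \<open>
  Polynomials in \<open>Re z\<close> and \<open>Im z\<close> along the circle form an algebra that is stable under
  differentiation; this gives the iterated derivatives of trigonometric polynomials with no explicit
  formula for them.
\<close>

lemma real_polynomial_cis_derivative:
  assumes "real_polynomial_function p"
  shows "\<exists>q. real_polynomial_function q \<and>
    (\<forall>x. ((\<lambda>x. p (cis (\<theta> * x))) has_real_derivative q (cis (\<theta> * x))) (at x))"
  using assms
proof induction
  case (linear f)
  have c: "((\<lambda>x. cis (\<theta> * x)) has_vector_derivative \<theta> *\<^sub>R (\<i> * cis (\<theta> * x))) (at x)" for x
  proof -
    have "((\<lambda>x. \<theta> * x) has_derivative (\<lambda>h. \<theta> * h)) (at x)"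
      by (rule has_derivative_mult_right has_derivative_ident)+
    from has_derivative_cis[OF this] show ?thesis
      by (simp add: has_vector_derivative_def ac_simps)
  qed
  have "real_polynomial_function (\<lambda>z. f (\<theta> *\<^sub>R (\<i> * z)))"
    by (intro real_polynomial_function.intros(1) bounded_linear_compose[OF linear]
        bounded_linear_compose[OF bounded_linear_scaleR_right] bounded_linear_mult_right)
  moreover have "((\<lambda>x. f (cis (\<theta> * x))) has_real_derivative f (\<theta> *\<^sub>R (\<i> * cis (\<theta> * x)))) (at x)" for x
    using bounded_linear.has_vector_derivative[OF linear c]
    by (simp add: has_real_derivative_iff_has_vector_derivative)
  ultimately show ?case
    by (intro exI[where x="\<lambda>z. f (\<theta> *\<^sub>R (\<i> * z))"] conjI allI)
next
  case (const c)
  have "real_polynomial_function (\<lambda>_. 0)" by (rule real_polynomial_function.intros(2))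
  then show ?case by (intro exI[where x="\<lambda>_. 0"] conjI allI DERIV_const)
next
  case (add f g)
  then obtain f' g' where *: "real_polynomial_function f'" "real_polynomial_function g'"
    "\<And>x. ((\<lambda>x. f (cis (\<theta> * x))) has_real_derivative f' (cis (\<theta> * x))) (at x)"
    "\<And>x. ((\<lambda>x. g (cis (\<theta> * x))) has_real_derivative g' (cis (\<theta> * x))) (at x)" by blast
  have "real_polynomial_function (\<lambda>z. f' z + g' z)"
    by (rule real_polynomial_function.intros(3) *)+
  then show ?case by (intro exI[where x="\<lambda>z. f' z + g' z"] conjI allI DERIV_add[OF *(3,4)])
next
  case (mult f g)
  then obtain f' g' where *: "real_polynomial_function f'" "real_polynomial_function g'"
    "\<And>x. ((\<lambda>x. f (cis (\<theta> * x))) has_real_derivative f' (cis (\<theta> * x))) (at x)"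
    "\<And>x. ((\<lambda>x. g (cis (\<theta> * x))) has_real_derivative g' (cis (\<theta> * x))) (at x)" by blast
  have "real_polynomial_function (\<lambda>z. f' z * g z + g' z * f z)"
    by (rule real_polynomial_function.intros(3,4) * mult(1,2))+
  then show ?case
    by (intro exI[where x="\<lambda>z. f' z * g z + g' z * f z"] conjI allI DERIV_mult[OF *(3,4)])
qed

lemma real_polynomial_cis_test_function:
  assumes L: "L > 0" and p: "real_polynomial_function p"
  shows "(\<lambda>x. p (cis (2 * pi / L * x))) \<in> test_functions L"
proof -
  let ?c = "\<lambda>x. cis (2 * pi / L * x)"
  have "\<exists>q. real_polynomial_function q \<and> (deriv ^^ n) (\<lambda>x. p (?c x)) = (\<lambda>x. q (?c x))" for n
  proof (induction n)
    case (Suc n)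
    then obtain q where q: "real_polynomial_function q" "(deriv ^^ n) (\<lambda>x. p (?c x)) = (\<lambda>x. q (?c x))"
      by blast
    obtain r where r: "real_polynomial_function r"
      "\<And>x. ((\<lambda>x. q (?c x)) has_real_derivative r (?c x)) (at x)"
      using real_polynomial_cis_derivative[OF q(1), of "2 * pi / L"] by blast
    have "deriv (\<lambda>x. q (?c x)) = (\<lambda>x. r (?c x))"
      using r(2) DERIV_imp_deriv by blast
    then show ?case using q r(1) by auto
  qed (use p in auto)
  then have "(deriv ^^ n) (\<lambda>x. p (?c x)) field_differentiable at x" for n x
    by (metis real_polynomial_cis_derivative field_differentiable_def)
  moreover have "?c (x + L) = ?c x" for x
  proof -
    have "2 * pi / L * (x + L) = 2 * pi / L * x + 2 * pi" using L by (simp add: field_simps)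
    then show ?thesis by (metis cis_mult cis_2pi mult.right_neutral)
  qed
  ultimately show ?thesis by (simp add: test_functions_def)
qed

section \<open>Density of the test functions\<close>

text \<open>
  A periodic continuous function descends to the circle. Continuity on the circle comes from the
  closed graph criterion: the graph is the continuous image of the compact interval \<open>[0, L]\<close>. This
  avoids any discussion of the branch point of the argument.
\<close>

lemma circle_factorization:
  fixes f :: "real \<Rightarrow> real"
  assumes L: "L > 0" and f: "continuous_on {0..L} f" "f 0 = f L"
  obtains F where "continuous_on ((\<lambda>x. cis (2 * pi / L * x)) ` {0..L}) F"
    "\<And>x. x \<in> {0..L} \<Longrightarrow> F (cis (2 * pi / L * x)) = f x"
proof -
  define c where "c x = cis (2 * pi / L * x)" for x
  define F where "F z = f (SOME x. x \<in> {0..L} \<and> c x = z)" for z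
  have c: "continuous_on {0..L} c"
    unfolding c_def by (intro continuous_intros)
  have eq: "f x = f y" if xy: "x \<in> {0..L}" "y \<in> {0..L}" "c x = c y" for x y
  proof -
    \<comment> \<open>Two points with the same image differ by a multiple of the period, so they coincide or are the
      two end points.\<close>
    obtain n :: int where "2 * pi / L * x = 2 * pi / L * y + 2 * pi * n"
      using xy(3) sin_cos_eq_iff[of "2 * pi / L * x" "2 * pi / L * y"] by (auto simp: c_def complex_eq_iff)
    then have "2 * pi * (x - y) = 2 * pi * (n * L)" using L by (simp add: field_simps)
    then have n: "x - y = n * L" by simp
    have "\<bar>x - y\<bar> \<le> L" using xy by auto
    then have "\<bar>real_of_int n\<bar> * L \<le> 1 * L" using L unfolding n by (simp add: abs_mult)
    then have "\<bar>n\<bar> \<le> 1" using L by simp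
    then consider "n = 0" | "n = 1" | "n = -1" by linarith
    then show ?thesis
    proof cases
      case 1 then show ?thesis using n by simp
    next
      case 2 then have "x = L" "y = 0" using n xy by auto
      then show ?thesis using f by simp
    next
      case 3 then have "x = 0" "y = L" using n xy by auto
      then show ?thesis using f by simp
    qed
  qed
  have Fc: "F (c x) = f x" if "x \<in> {0..L}" for x
  proof -
    have "(SOME y. y \<in> {0..L} \<and> c y = c x) \<in> {0..L} \<and> c (SOME y. y \<in> {0..L} \<and> c y = c x) = c x"
      by (rule someI[where x=x]) (use that in simp)
    then show ?thesis unfolding F_def using that eq by blast
  qed
  have "(\<lambda>z. (z, F z)) ` (c ` {0..L}) = (\<lambda>x. (c x, f x)) ` {0..L}"
    by (auto simp: image_image Fc)
  moreover have "compact ((\<lambda>x. (c x, f x)) ` {0..L})"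
    by (intro compact_continuous_image continuous_on_Pair c f) simp
  ultimately have "closed ((\<lambda>z. (z, F z)) ` (c ` {0..L}))"
    using compact_imp_closed by metis
  then have "continuous_on (c ` {0..L}) F"
  proof (rule continuous_from_closed_graph[rotated 2])
    show "compact (f ` {0..L})" by (rule compact_continuous_image[OF f(1)]) simp
    show "F \<in> c ` {0..L} \<rightarrow> f ` {0..L}" using Fc by auto
  qed
  then show ?thesis using Fc that unfolding c_def by blast
qed

text \<open>
  Stone--Weierstrass on the circle, pulled back to the interval.
\<close>

lemma test_functions_dense:
  fixes f :: "real \<Rightarrow> real"
  assumes L: "L > 0" and f: "continuous_on {0..L} f" "f 0 = f L" and e: "e > 0"
  obtains \<psi> where "\<psi> \<in> test_functions L" "\<And>x. x \<in> {0..L} \<Longrightarrow> \<bar>f x - \<psi> x\<bar> < e"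
proof -
  let ?c = "\<lambda>x. cis (2 * pi / L * x)"
  obtain F where F: "continuous_on (?c ` {0..L}) F" "\<And>x. x \<in> {0..L} \<Longrightarrow> F (?c x) = f x"
    using circle_factorization[OF L f] by blast
  have "compact (?c ` {0..L})"
    by (intro compact_continuous_image continuous_intros) simp
  then obtain p where p: "real_polynomial_function p" "\<And>z. z \<in> ?c ` {0..L} \<Longrightarrow> \<bar>F z - p z\<bar> < e"
    using Stone_Weierstrass_real_polynomial_function[OF _ F(1) e] by blast
  have "\<bar>f x - p (?c x)\<bar> < e" if "x \<in> {0..L}" for x
    using p(2)[of "?c x"] F(2)[OF that] that by simp
  then show ?thesis using that[OF real_polynomial_cis_test_function[OF L p(1)]] by blast
qed

lemma continuous_borel_measurable_domain_measure:
  fixes f :: "real \<Rightarrow> real"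
  shows "continuous_on UNIV f \<Longrightarrow> f \<in> borel_measurable (domain_measure L)"
  by (intro borel_measurable_domain_measure borel_measurable_continuous_onI)

lemma integrable_continuous_mult:
  fixes f w :: "real \<Rightarrow> real"
  assumes "continuous_on UNIV f" "integrable (domain_measure L) w"
  shows "integrable (domain_measure L) (\<lambda>x. f x * w x)"
proof -
  have "compact (f ` {0..L})"
    by (intro compact_continuous_image continuous_on_subset[OF assms(1)]) auto
  then obtain B where B: "\<And>x. x \<in> {0..L} \<Longrightarrow> norm (f x) \<le> B"
    by (meson compact_imp_bounded bounded_iff imageI)
  show ?thesis
  proof (rule Bochner_Integration.integrable_bound)
    show "integrable (domain_measure L) (\<lambda>x. B * w x)" using assms by simp
    show "(\<lambda>x. f x * w x) \<in> borel_measurable (domain_measure L)"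
      by (rule borel_measurable_times[OF continuous_borel_measurable_domain_measure[OF assms(1)]
            borel_measurable_integrable[OF assms(2)]])
    have "norm (f x * w x) \<le> norm (B * w x)" if "x \<in> space (domain_measure L)" for x
    proof -
      have "\<bar>f x\<bar> \<le> B" using B[of x] that by simp
      then have "\<bar>f x\<bar> \<le> \<bar>B\<bar>" by linarith
      then show ?thesis by (simp add: abs_mult mult_right_mono)
    qed
    then show "AE x in domain_measure L. norm (f x * w x) \<le> norm (B * w x)" by (rule AE_I2)
  qed
qed

lemma orthogonal_test_functions_continuous:
  fixes f w :: "real \<Rightarrow> real"
  assumes L: "L > 0" and w: "integrable (domain_measure L) w"
    and orth: "\<And>\<psi>. \<psi> \<in> test_functions L \<Longrightarrow> (\<integral>x. \<psi> x * w x \<partial>domain_measure L) = 0"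
    and f: "continuous_on UNIV f" "f 0 = f L"
  shows "(\<integral>x. f x * w x \<partial>domain_measure L) = 0"
proof -
  let ?D = "domain_measure L"
  have "\<bar>\<integral>x. f x * w x \<partial>?D\<bar> \<le> e * (\<integral>x. \<bar>w x\<bar> \<partial>?D)" if e: "e > 0" for e
  proof -
    obtain \<psi> where \<psi>: "\<psi> \<in> test_functions L" "\<And>x. x \<in> {0..L} \<Longrightarrow> \<bar>f x - \<psi> x\<bar> < e"
      using test_functions_dense[OF L continuous_on_subset[OF f(1)] f(2) e] by blast
    note i1 = integrable_continuous_mult[OF f(1) w]
    note i2 = integrable_continuous_mult[OF test_functions_continuous[OF \<psi>(1)] w]
    have "(\<integral>x. f x * w x \<partial>?D) = (\<integral>x. f x * w x - \<psi> x * w x \<partial>?D)"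
      using orth[OF \<psi>(1)] by (simp add: Bochner_Integration.integral_diff[OF i1 i2])
    also have "\<bar>\<dots>\<bar> \<le> (\<integral>x. \<bar>f x * w x - \<psi> x * w x\<bar> \<partial>?D)" by (rule integral_abs_bound)
    also have "\<dots> \<le> (\<integral>x. e * \<bar>w x\<bar> \<partial>?D)"
    proof (rule integral_mono)
      show "integrable ?D (\<lambda>x. \<bar>f x * w x - \<psi> x * w x\<bar>)" using i1 i2 by simp
      show "integrable ?D (\<lambda>x. e * \<bar>w x\<bar>)" using w by simp
      fix x assume "x \<in> space ?D"
      then have "\<bar>f x - \<psi> x\<bar> \<le> e" using \<psi>(2)[of x] by simp
      then show "\<bar>f x * w x - \<psi> x * w x\<bar> \<le> e * \<bar>w x\<bar>"
        unfolding left_diff_distrib[symmetric] abs_mult by (rule mult_right_mono) simp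
    qed
    finally show ?thesis by simp
  qed
  moreover define K where "K = (\<integral>x. \<bar>w x\<bar> \<partial>?D)"
  ultimately have bound: "\<bar>\<integral>x. f x * w x \<partial>?D\<bar> \<le> e * K" if "e > 0" for e
    using that by blast
  have K: "0 \<le> K" by (simp add: K_def)
  have "\<bar>\<integral>x. f x * w x \<partial>?D\<bar> \<le> 0 + e" if e: "e > 0" for e
  proof -
    \<comment> \<open>\<open>K + 1\<close> instead of \<open>K\<close>, which may be zero.\<close>
    have "\<bar>\<integral>x. f x * w x \<partial>?D\<bar> \<le> e / (K + 1) * K"
      using e K by (intro bound divide_pos_pos) auto
    also have "\<dots> \<le> e"
      using e K by (simp add: field_simps)
    finally show ?thesis by simp
  qed
  then have "\<bar>\<integral>x. f x * w x \<partial>?D\<bar> \<le> 0" by (rule field_le_epsilon)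
  then show ?thesis by simp
qed

text \<open>
  Test against the sign of \<open>w\<close>. It is an almost everywhere limit of continuous functions, which may be
  truncated to \<open>[-1, 1]\<close> and multiplied by cut-offs that vanish at both end points, hence agree there;
  dominated convergence then gives \<open>\<integral> \<bar>w\<bar> = 0\<close>.
\<close>

lemma orthogonal_test_functions_AE_zero:
  fixes w :: "real \<Rightarrow> real"
  assumes L: "L > 0" and w: "integrable (domain_measure L) w"
    and orth: "\<And>\<psi>. \<psi> \<in> test_functions L \<Longrightarrow> (\<integral>x. \<psi> x * w x \<partial>domain_measure L) = 0"
  shows "AE x in domain_measure L. w x = 0"
proof -
  let ?D = "domain_measure L"
  \<comment> \<open>Extended by $0$ outside the interval, to be measurable on the whole line.\<close>
  define s where "s x = sgn (indicator {0<..<L} x *\<^sub>R w x)" for x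
  have "(\<lambda>x. indicator {0<..<L} x *\<^sub>R w x) \<in> borel_measurable lborel"
    using borel_measurable_integrable[OF w]
    unfolding domain_measure_def by (subst (asm) borel_measurable_restrict_space_iff) auto
  then have "(\<lambda>x. indicator {0<..<L} x *\<^sub>R w x) \<in> borel_measurable borel" by simp
  then have s: "s \<in> borel_measurable borel" unfolding s_def sgn_if by measurable
  then have "s \<in> borel_measurable lebesgue" by (intro measurable_completion) simp
  then have "s measurable_on UNIV" by (intro lebesgue_measurable_imp_measurable_on) auto
  then obtain N g where N: "negligible N" and g: "\<And>n. continuous_on UNIV (g n)"
    and lim: "\<And>x. x \<notin> N \<Longrightarrow> (\<lambda>n. g n x) \<longlonglongrightarrow> s x"
    unfolding measurable_on_def by auto
  define h where "h n x = max (-1) (min 1 (g n x)) * min 1 (real n * max 0 (min x (L - x)))" for n x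
  have h: "continuous_on UNIV (h n)" for n
    unfolding h_def by (intro continuous_intros g)
  have h0: "(\<integral>x. h n x * w x \<partial>?D) = 0" for n
    by (rule orthogonal_test_functions_continuous[OF L w orth h]) (auto simp: h_def L)
  have hb: "\<bar>h n x\<bar> \<le> 1" for n x
  proof -
    have "\<bar>max (-1) (min 1 (g n x))\<bar> \<le> 1" by linarith
    moreover have "\<bar>min 1 (real n * max 0 (min x (L - x)))\<bar> \<le> 1"
    proof -
      have "0 \<le> real n * max 0 (min x (L - x))" by simp
      then show ?thesis by linarith
    qed
    ultimately show ?thesis unfolding h_def abs_mult by (simp add: mult_le_one)
  qed
  have hlim: "(\<lambda>n. h n x) \<longlonglongrightarrow> s x" if "x \<notin> N" "0 < x" "x < L" for x
  proof -
    have clamp: "(\<lambda>n. max (-1) (min 1 (g n x))) \<longlonglongrightarrow> max (-1) (min 1 (s x))"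
      by (intro tendsto_intros lim that)
    have sx: "max (-1) (min 1 (s x)) = s x" by (simp add: s_def sgn_if)
    have "(\<lambda>n. min 1 (real n * max 0 (min x (L - x)))) \<longlonglongrightarrow> 1"
    proof (rule tendsto_eventually)
      have "0 < min x (L - x)" using that by simp
      then obtain m :: nat where m: "1 < real m * min x (L - x)"
        using reals_Archimedean3 by blast
      have "1 \<le> real n * min x (L - x)" if "n \<ge> m" for n
      proof -
        have "real m * min x (L - x) \<le> real n * min x (L - x)"
          using that \<open>0 < min x (L - x)\<close> by (intro mult_right_mono) auto
        then show ?thesis using m by linarith
      qed
      then show "\<forall>\<^sub>F n in sequentially. min 1 (real n * max 0 (min x (L - x))) = 1"
        unfolding eventually_sequentially using \<open>0 < min x (L - x)\<close> by (intro exI[of _ m]) auto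
    qed
    from tendsto_mult[OF clamp this] show ?thesis unfolding h_def sx by simp
  qed
  have "AE x in lborel. x \<notin> N"
    using N AE_completion_iff[of "\<lambda>x. x \<notin> N" lborel]
    by (simp add: negligible_iff_null_sets AE_not_in)
  then have AEN: "AE x in ?D. x \<notin> N"
    unfolding domain_measure_def by (subst AE_restrict_space_iff) (auto elim: eventually_mono)
  have sw: "s x * w x = \<bar>w x\<bar>" if "x \<in> space ?D" for x
    using that by (simp add: s_def abs_sgn mult.commute)
  have "(\<lambda>n. \<integral>x. h n x * w x \<partial>?D) \<longlonglongrightarrow> (\<integral>x. s x * w x \<partial>?D)"
  proof (rule integral_dominated_convergence)
    show "(\<lambda>x. s x * w x) \<in> borel_measurable ?D"
      using borel_measurable_domain_measure[OF s] borel_measurable_integrable[OF w]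
      by (rule borel_measurable_times)
    show "(\<lambda>x. h n x * w x) \<in> borel_measurable ?D" for n
      using continuous_borel_measurable_domain_measure[OF h] borel_measurable_integrable[OF w]
      by (rule borel_measurable_times)
    show "integrable ?D (\<lambda>x. \<bar>w x\<bar>)" using w by simp
    show "AE x in ?D. (\<lambda>n. h n x * w x) \<longlonglongrightarrow> s x * w x"
      using AEN AE_space by eventually_elim (auto intro!: tendsto_mult hlim)
    show "AE x in ?D. norm (h n x * w x) \<le> \<bar>w x\<bar>" for n
      using hb by (intro AE_I2) (simp add: abs_mult mult_left_le_one_le)
  qed
  then have "(\<integral>x. s x * w x \<partial>?D) = 0" by (simp add: h0 LIMSEQ_const_iff)
  moreover have "(\<integral>x. s x * w x \<partial>?D) = (\<integral>x. \<bar>w x\<bar> \<partial>?D)"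
    by (rule Bochner_Integration.integral_cong) (use sw in auto)
  ultimately have "(\<integral>x. \<bar>w x\<bar> \<partial>?D) = 0" by simp
  then show ?thesis
    using integral_nonneg_eq_0_iff_AE[of ?D "\<lambda>x. \<bar>w x\<bar>"] w by simp
qed

section \<open>Periodic weak derivatives\<close>

lemma test_functions_diff_const:
  assumes "\<phi> \<in> test_functions L" shows "(\<lambda>x. \<phi> x - m) \<in> test_functions L"
proof -
  have D: "((\<lambda>x. \<phi> x - m) has_real_derivative deriv \<phi> x) (at x)" for x
    using DERIV_diff[OF test_functions_DERIV[OF assms] DERIV_const] by simp
  have "(deriv ^^ n) (\<lambda>x. \<phi> x - m) field_differentiable at x" for n x
  proof (cases n)
    case 0 then show ?thesis using D by (auto simp: field_differentiable_def)
  next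
    case (Suc k)
    have "deriv (\<lambda>x. \<phi> x - m) = deriv \<phi>" using DERIV_imp_deriv[OF D] by blast
    then have "(deriv ^^ n) (\<lambda>x. \<phi> x - m) = (deriv ^^ n) \<phi>"
      by (simp add: Suc funpow_Suc_right del: funpow.simps)
    then show ?thesis using assms by (simp add: test_functions_def)
  qed
  then show ?thesis using assms by (simp add: test_functions_def)
qed

text \<open>
  Every test function of mean zero is the derivative of a test function, so \<open>v\<close> minus its mean is
  orthogonal to all test functions.
\<close>

lemma du_Bois_Reymond_periodic:
  fixes v :: "real \<Rightarrow> real"
  assumes L: "L > 0" and v: "integrable (domain_measure L) v"
    and orth: "\<And>\<phi>. \<phi> \<in> test_functions L \<Longrightarrow> (\<integral>x. deriv \<phi> x * v x \<partial>domain_measure L) = 0"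
  obtains c where "AE x in domain_measure L. v x = c"
proof -
  let ?D = "domain_measure L"
  interpret finite_measure ?D by (rule finite_measure_domain_measure)
  define c where "c = (\<integral>x. v x \<partial>?D) / L"
  have "(\<integral>x. \<psi> x * (v x - c) \<partial>?D) = 0" if \<psi>: "\<psi> \<in> test_functions L" for \<psi>
  proof -
    define m where "m = (\<integral>x. \<psi> x \<partial>?D) / L"
    have i: "integrable ?D \<psi>"
      using integrable_continuous_mult[OF test_functions_continuous[OF \<psi>], of L "\<lambda>_. 1"] by simp
    have iv: "integrable ?D (\<lambda>x. \<psi> x * v x)"
      by (rule integrable_continuous_mult[OF test_functions_continuous[OF \<psi>] v])
    have "(\<integral>x. \<psi> x - m \<partial>?D) = 0"
      using i measure_space_domain_measure[OF L] L by (simp add: m_def)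
    then obtain \<Psi> where "\<Psi> \<in> test_functions L" "deriv \<Psi> = (\<lambda>x. \<psi> x - m)"
      using test_function_primitive[OF L test_functions_diff_const[OF \<psi>]] by blast
    with orth have "(\<integral>x. (\<psi> x - m) * v x \<partial>?D) = 0" by fastforce
    then have "(\<integral>x. \<psi> x * v x \<partial>?D) = m * (\<integral>x. v x \<partial>?D)"
      using iv v by (simp add: left_diff_distrib)
    moreover have "(\<integral>x. \<psi> x * (v x - c) \<partial>?D) = (\<integral>x. \<psi> x * v x \<partial>?D) - c * (\<integral>x. \<psi> x \<partial>?D)"
      using iv i by (simp add: right_diff_distrib mult.commute)
    ultimately show ?thesis by (simp add: c_def m_def)
  qed
  then have "AE x in ?D. v x - c = 0"
    using v by (intro orthogonal_test_functions_AE_zero[OF L]) auto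
  then show ?thesis using that[of c] by simp
qed

lemma integrable_triangle:
  fixes a b :: "real \<Rightarrow> real"
  assumes a: "integrable (domain_measure L) a" and b: "integrable (domain_measure L) b"
  shows "integrable (domain_measure L \<Otimes>\<^sub>M domain_measure L) (\<lambda>(x, y). if y < x then a x * b y else 0)"
proof -
  let ?D = "domain_measure L"
  interpret finite_measure ?D by (rule finite_measure_domain_measure)
  interpret P: pair_sigma_finite ?D ?D ..
  note am = borel_measurable_integrable[OF a] and bm = borel_measurable_integrable[OF b]
  have ab: "(\<lambda>p. a (fst p) * b (snd p)) \<in> borel_measurable (?D \<Otimes>\<^sub>M ?D)"
    by (intro borel_measurable_times measurable_compose[OF measurable_fst am]
        measurable_compose[OF measurable_snd bm])
  have "{p \<in> space (?D \<Otimes>\<^sub>M ?D). snd p < fst p} \<in> sets (?D \<Otimes>\<^sub>M ?D)"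
    by (rule borel_measurable_less[OF measurable_compose[OF measurable_snd id_measurable_domain_measure]
          measurable_compose[OF measurable_fst id_measurable_domain_measure]])
  then have m: "(\<lambda>(x, y). if y < x then a x * b y else 0) \<in> borel_measurable (?D \<Otimes>\<^sub>M ?D)"
    unfolding case_prod_beta by (intro measurable_If ab) auto
  have "integrable (?D \<Otimes>\<^sub>M ?D) (\<lambda>p. a (fst p) * b (snd p))"
  proof (rule P.Fubini_integrable[OF ab])
    show "integrable ?D (\<lambda>x. \<integral>y. norm (a (fst (x, y)) * b (snd (x, y))) \<partial>?D)"
      using a by (simp add: abs_mult)
    show "AE x in ?D. integrable ?D (\<lambda>y. a (fst (x, y)) * b (snd (x, y)))"
      using b by simp
  qed
  then show ?thesis
    by (rule Bochner_Integration.integrable_bound[OF _ m]) auto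
qed

text \<open>
  Fubini on the triangle \<open>y < x\<close>. It serves twice: with \<open>a = \<phi>'\<close> it is integration by parts for the
  primitive of \<open>b\<close>, and with \<open>a = b\<close> it computes the integral of a function against its own primitive.
\<close>

lemma triangle_sections:
  fixes a b :: "real \<Rightarrow> real"
  assumes a: "integrable (domain_measure L) a" and b: "integrable (domain_measure L) b"
  shows "integrable (domain_measure L) (\<lambda>x. a x * (\<integral>y. (if y < x then b y else 0) \<partial>domain_measure L))"
    and "(\<integral>x. a x * (\<integral>y. (if y < x then b y else 0) \<partial>domain_measure L) \<partial>domain_measure L) =
      (\<integral>y. b y * (\<integral>x. (if y < x then a x else 0) \<partial>domain_measure L) \<partial>domain_measure L)"
proof -
  let ?D = "domain_measure L"
  interpret finite_measure ?D by (rule finite_measure_domain_measure)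
  interpret P: pair_sigma_finite ?D ?D ..
  have i: "integrable (?D \<Otimes>\<^sub>M ?D) (\<lambda>(x, y). if y < x then a x * b y else 0)"
    by (rule integrable_triangle[OF a b])
  have y: "(\<integral>y. (if y < x then a x * b y else 0) \<partial>?D) = a x * (\<integral>y. (if y < x then b y else 0) \<partial>?D)" for x
    unfolding integral_mult_right_zero[symmetric] by (rule Bochner_Integration.integral_cong) auto
  have x: "(\<integral>x. (if y < x then a x * b y else 0) \<partial>?D) = b y * (\<integral>x. (if y < x then a x else 0) \<partial>?D)" for y
    unfolding integral_mult_right_zero[symmetric] by (rule Bochner_Integration.integral_cong) auto
  show "integrable ?D (\<lambda>x. a x * (\<integral>y. (if y < x then b y else 0) \<partial>?D))"
    using P.integrable_fst[OF i] unfolding y .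
  show "(\<integral>x. a x * (\<integral>y. (if y < x then b y else 0) \<partial>?D) \<partial>?D) =
      (\<integral>y. b y * (\<integral>x. (if y < x then a x else 0) \<partial>?D) \<partial>?D)"
    using P.Fubini_integral[OF i] unfolding x y by simp
qed

text \<open>
  This is where periodicity enters: the constant $1$ is a test function.
\<close>

lemma weak_derivative_mean_zero:
  fixes v g :: "real \<Rightarrow> real"
  assumes "weak_derivative L v g" shows "integral\<^sup>L (domain_measure L) g = 0"
proof -
  have "ddx (regular_distribution L v) (\<lambda>_. 1) = regular_distribution L g (\<lambda>_. 1)"
    using assms const_test_function unfolding weak_derivative_def by blast
  then show ?thesis by (simp add: ddx_def regular_distribution_def)
qed

text \<open>
  The primitive \<open>G\<close> of \<open>g\<close> also has weak derivative \<open>g\<close>: the boundary term \<open>\<phi> L * \<integral> g\<close> of the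
  integration by parts vanishes since \<open>g\<close> has mean zero. Hence \<open>v - G\<close> is orthogonal to all
  derivatives of test functions.
\<close>

lemma weak_derivative_primitive:
  fixes v g :: "real \<Rightarrow> real"
  assumes L: "L > 0" and v: "integrable (domain_measure L) v" and g: "integrable (domain_measure L) g"
    and w: "weak_derivative L v g"
  obtains c where
    "AE x in domain_measure L. v x = c + (\<integral>y. (if y < x then g y else 0) \<partial>domain_measure L)"
proof -
  let ?D = "domain_measure L"
  interpret finite_measure ?D by (rule finite_measure_domain_measure)
  define G where "G x = (\<integral>y. (if y < x then g y else 0) \<partial>?D)" for x
  have G: "integrable ?D G"
    using triangle_sections(1)[of L "\<lambda>_. 1" g] g by (simp add: G_def[abs_def])
  have "(\<integral>x. deriv \<phi> x * (v x - G x) \<partial>?D) = 0" if \<phi>: "\<phi> \<in> test_functions L" for \<phi>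
  proof -
    note cd = continuous_deriv_test_functions[OF \<phi>]
    have id: "integrable ?D (deriv \<phi>)"
      using integrable_continuous_mult[OF cd, of L "\<lambda>_. 1"] by simp
    have ig: "integrable ?D (\<lambda>x. \<phi> x * g x)"
      by (rule integrable_continuous_mult[OF test_functions_continuous[OF \<phi>] g])
    have "(\<integral>x. deriv \<phi> x * G x \<partial>?D) = (\<integral>y. g y * (\<integral>x. (if y < x then deriv \<phi> x else 0) \<partial>?D) \<partial>?D)"
      unfolding G_def by (rule triangle_sections(2)[OF id g])
    also have "\<dots> = (\<integral>y. \<phi> L * g y - \<phi> y * g y \<partial>?D)"
    proof (rule Bochner_Integration.integral_cong[OF refl])
      fix y assume "y \<in> space ?D"
      then have y: "0 \<le> y" "y \<le> L" by auto
      have "(\<integral>x. (if y < x then deriv \<phi> x else 0) \<partial>?D) = (\<integral>x. deriv \<phi> x * indicator {y<..} x \<partial>?D)"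
        by (rule Bochner_Integration.integral_cong) auto
      also have "\<dots> = \<phi> L - \<phi> y"
        by (rule integral_domain_measure_FTC[OF test_functions_DERIV[OF \<phi>] cd y])
      finally have "(\<integral>x. (if y < x then deriv \<phi> x else 0) \<partial>?D) = \<phi> L - \<phi> y" .
      then show "g y * (\<integral>x. (if y < x then deriv \<phi> x else 0) \<partial>?D) = \<phi> L * g y - \<phi> y * g y"
        by (simp only: right_diff_distrib mult.commute)
    qed
    also have "\<dots> = - (\<integral>x. \<phi> x * g x \<partial>?D)"
      using g ig weak_derivative_mean_zero[OF w] by simp
    also have "\<dots> = (\<integral>x. deriv \<phi> x * v x \<partial>?D)"
    proof -
      have "ddx (regular_distribution L v) \<phi> = regular_distribution L g \<phi>"
        using w \<phi> unfolding weak_derivative_def by blast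
      then have "- (\<integral>x. deriv \<phi> x * v x \<partial>?D) = (\<integral>x. \<phi> x * g x \<partial>?D)"
        by (simp only: ddx_def regular_distribution_def real_scaleR_def)
      then show ?thesis by linarith
    qed
    finally show ?thesis
      using integrable_continuous_mult[OF cd v] integrable_continuous_mult[OF cd G]
      by (simp add: right_diff_distrib)
  qed
  then obtain c where "AE x in ?D. v x - G x = c"
    using du_Bois_Reymond_periodic[OF L Bochner_Integration.integrable_diff[OF v G]] by blast
  then have "AE x in ?D. v x = c + G x" by eventually_elim simp
  then show ?thesis using that unfolding G_def by blast
qed

lemma wderiv_weak_derivative:
  assumes "f \<in> H1 L"
  shows "wderiv L f \<in> L2 L" "weak_derivative L f (wderiv L f)"
  using someI_ex[of "\<lambda>g. g \<in> L2 L \<and> weak_derivative L f g"] assms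
  unfolding wderiv_def[symmetric] by (auto simp: H1_def)

text \<open>
  Formally \<open>v v' = (v\<^sup>2 / 2)'\<close>, whose integral over a period is zero. As \<open>v = c + G\<close> with \<open>G\<close> the
  primitive of \<open>g = v'\<close>, and \<open>\<integral> g = 0\<close>, it suffices that \<open>\<integral> g G\<close> vanishes; exchanging the two halves of
  the square \<open>[0, L] \<times> [0, L]\<close> turns this integral into its own negative.
\<close>

lemma integral_mult_wderiv_zero:
  fixes v :: "real \<Rightarrow> real"
  assumes L: "L > 0" and v: "v \<in> H1 L"
  shows "(\<integral>x. v x * wderiv L v x \<partial>domain_measure L) = 0"
proof -
  let ?D = "domain_measure L"
  define g where "g = wderiv L v"
  define G where "G x = (\<integral>y. (if y < x then g y else 0) \<partial>?D)" for x
  have vi: "integrable ?D v" using v L2_integrable by (auto simp: H1_def)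
  have gi: "integrable ?D g" using L2_integrable wderiv_weak_derivative(1)[OF v] by (simp add: g_def)
  have w: "weak_derivative L v g" using wderiv_weak_derivative(2)[OF v] by (simp add: g_def)
  note mean = weak_derivative_mean_zero[OF w]
  obtain c where c: "AE x in ?D. v x = c + G x"
    using weak_derivative_primitive[OF L vi gi w] unfolding G_def by blast
  have gG: "integrable ?D (\<lambda>x. g x * G x)"
    unfolding G_def by (rule triangle_sections(1)[OF gi gi])
  have "(\<integral>x. g x * G x \<partial>?D) = (\<integral>y. g y * (\<integral>x. (if y < x then g x else 0) \<partial>?D) \<partial>?D)"
    unfolding G_def by (rule triangle_sections(2)[OF gi gi])
  also have "\<dots> = (\<integral>y. - (g y * G y) \<partial>?D)"
  proof (rule Bochner_Integration.integral_cong[OF refl])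
    fix y
    have int: "integrable ?D (\<lambda>x. if P x then g x else 0)" if "{x \<in> space ?D. P x} \<in> sets ?D" for P
      using borel_measurable_integrable[OF gi]
      by (intro Bochner_Integration.integrable_bound[OF gi] measurable_If that) auto
    have m: "{x \<in> space ?D. y < x} \<in> sets ?D" "{x \<in> space ?D. x < y} \<in> sets ?D"
      by (rule borel_measurable_less[OF borel_measurable_const id_measurable_domain_measure]
          borel_measurable_less[OF id_measurable_domain_measure borel_measurable_const])+
    have "0 = integral\<^sup>L ?D g" using mean by simp
    also have "\<dots> = (\<integral>x. (if y < x then g x else 0) + (if x < y then g x else 0) \<partial>?D)"
    proof (rule integral_cong_AE)
      have "AE x in ?D. x \<noteq> y"
        unfolding domain_measure_def using AE_lborel_singleton[of y]
        by (subst AE_restrict_space_iff) (auto elim: eventually_mono)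
      then show "AE x in ?D. g x = (if y < x then g x else 0) + (if x < y then g x else 0)"
        by eventually_elim auto
    qed (use int[OF m(1)] int[OF m(2)] gi in \<open>simp_all add: borel_measurable_add borel_measurable_integrable\<close>)
    also have "\<dots> = (\<integral>x. (if y < x then g x else 0) \<partial>?D) + G y"
      unfolding G_def by (rule Bochner_Integration.integral_add[OF int[OF m(1)] int[OF m(2)]])
    finally have "(\<integral>x. (if y < x then g x else 0) \<partial>?D) = - G y" by simp
    then show "g y * (\<integral>x. (if y < x then g x else 0) \<partial>?D) = - (g y * G y)" by simp
  qed
  also have "\<dots> = - (\<integral>x. g x * G x \<partial>?D)" by simp
  finally have zero: "(\<integral>x. g x * G x \<partial>?D) = 0" by simp
  have "(\<integral>x. v x * g x \<partial>?D) = (\<integral>x. c * g x + g x * G x \<partial>?D)"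
  proof (rule integral_cong_AE)
    show "AE x in ?D. v x * g x = c * g x + g x * G x"
      using c by eventually_elim (simp add: algebra_simps)
    show "(\<lambda>x. v x * g x) \<in> borel_measurable ?D"
      using vi gi by (intro borel_measurable_times borel_measurable_integrable[OF vi] borel_measurable_integrable[OF gi])
    show "(\<lambda>x. c * g x + g x * G x) \<in> borel_measurable ?D"
      using gi gG by (intro borel_measurable_integrable) simp
  qed
  also have "\<dots> = 0" using gi gG mean zero by simp
  finally show ?thesis by (simp add: g_def)
qed

text \<open>
  Against the test function $1$ the conservative terms, which are distributional derivatives,
  disappear, and only the transport term \<open>v v'\<close> is left.
\<close>

lemma kdv_drift_const_zero:
  assumes "L > 0" "v \<in> H1 L"
  shows "kdv_drift L \<gamma> u v (\<lambda>_. 1) = 0"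
proof -
  have "regular_distribution L (\<lambda>x. v x * wderiv L v x) (\<lambda>_. 1) = 0"
    using integral_mult_wderiv_zero[OF assms] by (simp add: regular_distribution_def)
  then show ?thesis by (simp add: kdv_drift_def ddx_def) (simp add: regular_distribution_def)
qed

section \<open>Spatial means of random elements of $H^1$\<close>

lemma H1_L2: "f \<in> H1 L \<Longrightarrow> f \<in> L2 L"
  by (simp add: H1_def)

lemma abs_integral_le_H1norm:
  fixes f :: "real \<Rightarrow> real"
  assumes "L > 0" "f \<in> L2 L"
  shows "\<bar>integral\<^sup>L (domain_measure L) f\<bar> \<le> sqrt L * H1norm L f"
proof -
  have "sqrt L * L2norm L f \<le> sqrt L * H1norm L f"
    using assms(1) by (intro mult_left_mono L2norm_le_H1norm) simp
  then show ?thesis using abs_integral_le_L2norm[OF assms] by linarith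
qed

text \<open>
  The spatial mean is Lipschitz for the $H^1$ norm, so its superlevel sets are open in $H^1$.
\<close>

lemma integral_H1_borel_measurable:
  assumes L: "L > 0"
  shows "(\<lambda>f. integral\<^sup>L (domain_measure L) f :: real) \<in> borel_measurable (H1_borel L)"
proof (rule borel_measurableI_greater)
  fix y :: real
  let ?D = "domain_measure L" and ?U = "{f \<in> H1 L. y < integral\<^sup>L (domain_measure L) f}"
  have sub: "{U. H1_open L U} \<subseteq> Pow (H1 L :: (real \<Rightarrow> real) set)" by (auto simp: H1_open_def)
  have "H1_open L ?U"
    unfolding H1_open_def
  proof (intro conjI ballI)
    fix f assume f: "f \<in> ?U"
    define \<epsilon> where "\<epsilon> = (integral\<^sup>L ?D f - y) / sqrt L"
    have "g \<in> ?U" if g: "g \<in> H1 L" "H1norm L (\<lambda>x. g x - f x) < \<epsilon>" for g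
    proof -
      have fl: "f \<in> L2 L" and gl: "g \<in> L2 L" using f g by (auto simp: H1_L2)
      have "\<bar>integral\<^sup>L ?D g - integral\<^sup>L ?D f\<bar> = \<bar>\<integral>x. g x - f x \<partial>?D\<bar>"
        by (simp add: Bochner_Integration.integral_diff[OF L2_integrable[OF gl] L2_integrable[OF fl]])
      also have "\<dots> \<le> sqrt L * H1norm L (\<lambda>x. g x - f x)"
        by (rule abs_integral_le_H1norm[OF L L2_diff[OF gl fl]])
      also have "\<dots> < sqrt L * \<epsilon>" using g(2) L by simp
      also have "\<dots> = integral\<^sup>L ?D f - y" using L by (simp add: \<epsilon>_def)
      finally show ?thesis using g(1) by (simp add: abs_if split: if_splits)
    qed
    moreover have "\<epsilon> > 0" using f L by (simp add: \<epsilon>_def)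
    ultimately show "\<exists>\<epsilon>>0. \<forall>g\<in>H1 L. H1norm L (\<lambda>x. g x - f x) < \<epsilon> \<longrightarrow> g \<in> ?U" by blast
  qed auto
  then have "?U \<in> sets (H1_borel L)"
    unfolding H1_borel_def sets_measure_of[OF sub] by (intro sigma_sets.Basic) simp
  then show "{f \<in> space (H1_borel L). y < integral\<^sup>L ?D f} \<in> sets (H1_borel L)"
    by (simp add: H1_borel_def space_measure_of[OF sub])
qed

lemma measurable_H1_borel_in_H1:
  fixes Z :: "'w \<Rightarrow> real \<Rightarrow> 'a::{banach, second_countable_topology}"
  assumes "Z \<in> measurable M (H1_borel L)" "\<omega> \<in> space M" shows "Z \<omega> \<in> H1 L"
proof -
  have sub: "{U. H1_open L U} \<subseteq> Pow (H1 L :: (real \<Rightarrow> 'a) set)" by (auto simp: H1_open_def)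
  show ?thesis using measurable_space[OF assms] by (simp add: H1_borel_def space_measure_of[OF sub])
qed

section \<open>The stochastic integral has mean zero\<close>

text \<open>
  The case \<open>t = 0\<close> is separate because the increments have a density only over intervals of
  positive length.
\<close>

lemma brownian_motion_mean_zero:
  assumes F: "filtered_prob_space M F" and B: "brownian_motion M F B" and t: "t \<ge> 0"
  shows "integrable M (B t)" "integral\<^sup>L M (B t) = 0"
proof -
  have m: "B s \<in> borel_measurable M" if "s \<ge> 0" for s
    using B F that unfolding brownian_motion_def filtered_prob_space_def
    by (meson measurable_from_subalg)
  have B0: "AE \<omega> in M. B 0 \<omega> = 0" using B by (simp add: brownian_motion_def)
  have "has_bochner_integral M (B t) 0"
  proof (cases "t = 0")
    case True
    have "has_bochner_integral M (\<lambda>_. 0 :: real) 0" by (simp add: has_bochner_integral_iff)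
    then show ?thesis
      using B0 m[OF t] True
      by (subst has_bochner_integral_cong_AE[where g="\<lambda>_. 0"]) auto
  next
    case False
    let ?d = "normal_density 0 (sqrt (t - 0))"
    have pos: "0 < sqrt (t - 0)" using t False by simp
    have D: "distributed M lborel (\<lambda>\<omega>. B t \<omega> - B 0 \<omega>) ?d"
      using B t False unfolding brownian_motion_def by auto
    have odd: "has_bochner_integral lborel (\<lambda>x. ?d x * x) 0"
      using normal_moment_odd[OF pos, of 0 0] by simp
    have "integrable M (\<lambda>\<omega>. B t \<omega> - B 0 \<omega>)"
      using distributed_integrable_var[OF D] odd by (auto simp: has_bochner_integral_iff)
    moreover have "(\<integral>\<omega>. B t \<omega> - B 0 \<omega> \<partial>M) = 0"
      using distributed_integral[OF D, of "\<lambda>x. x"] odd by (simp add: has_bochner_integral_iff)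
    ultimately have "has_bochner_integral M (\<lambda>\<omega>. B t \<omega> - B 0 \<omega>) 0"
      by (simp add: has_bochner_integral_iff)
    moreover have "AE \<omega> in M. B t \<omega> - B 0 \<omega> = B t \<omega>" using B0 by eventually_elim simp
    ultimately show ?thesis
      using has_bochner_integral_cong_AE[of "\<lambda>\<omega>. B t \<omega> - B 0 \<omega>" M "B t" 0] m[OF t] m[of 0] by auto
  qed
  then show "integrable M (B t)" "integral\<^sup>L M (B t) = 0" by (simp_all add: has_bochner_integral_iff)
qed

text \<open>
  The mean is at most the root mean square, since the variance is nonnegative; so the means pass to
  the limit.
\<close>

lemma (in prob_space) expectation_zero_L2_limit:
  fixes X :: "'a \<Rightarrow> real"
  assumes X: "X \<in> borel_measurable M"
    and S: "\<And>n. integrable M (S n)" "\<And>n. expectation (S n) = 0"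
    and lim: "(\<lambda>n. \<integral>\<^sup>+\<omega>. ennreal ((X \<omega> - S n \<omega>)\<^sup>2) \<partial>M) \<longlonglongrightarrow> 0"
  shows "integrable M X" "expectation X = 0"
proof -
  have ev: "\<exists>n. integrable M (\<lambda>\<omega>. X \<omega> - S n \<omega>) \<and> \<bar>expectation (\<lambda>\<omega>. X \<omega> - S n \<omega>)\<bar> \<le> e"
    if e: "e > 0" for e
  proof -
    have "eventually (\<lambda>n. (\<integral>\<^sup>+\<omega>. ennreal ((X \<omega> - S n \<omega>)\<^sup>2) \<partial>M) < ennreal (e\<^sup>2)) sequentially"
      using e by (intro order_tendstoD(2)[OF lim]) simp
    then obtain n where n: "(\<integral>\<^sup>+\<omega>. ennreal ((X \<omega> - S n \<omega>)\<^sup>2) \<partial>M) < ennreal (e\<^sup>2)"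
      unfolding eventually_sequentially by blast
    define Y where "Y = (\<lambda>\<omega>. X \<omega> - S n \<omega>)"
    have Y: "Y \<in> borel_measurable M"
      unfolding Y_def by (rule borel_measurable_diff[OF X borel_measurable_integrable[OF S(1)]])
    have fin: "(\<integral>\<^sup>+\<omega>. ennreal ((Y \<omega>)\<^sup>2) \<partial>M) < ennreal (e\<^sup>2)" using n by (simp add: Y_def)
    have Y2: "integrable M (\<lambda>\<omega>. (Y \<omega>)\<^sup>2)"
      using fin Y by (intro integrableI_nonneg) (auto intro: less_trans)
    have Y1: "integrable M Y" by (rule square_integrable_imp_integrable[OF Y Y2])
    have "(\<integral>\<^sup>+\<omega>. ennreal ((Y \<omega>)\<^sup>2) \<partial>M) = ennreal (expectation (\<lambda>\<omega>. (Y \<omega>)\<^sup>2))"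
      using Y2 by (intro nn_integral_eq_integral) auto
    then have "expectation (\<lambda>\<omega>. (Y \<omega>)\<^sup>2) \<le> e\<^sup>2" using fin e by (simp add: ennreal_less_iff)
    moreover have "0 \<le> variance Y" by (rule variance_positive)
    then have "(expectation Y)\<^sup>2 \<le> expectation (\<lambda>\<omega>. (Y \<omega>)\<^sup>2)"
      using variance_eq[OF Y1 Y2] by simp
    ultimately have "\<bar>expectation Y\<bar>\<^sup>2 \<le> e\<^sup>2" by simp
    then have "\<bar>expectation Y\<bar> \<le> e" using e by (rule power2_le_imp_le[OF _ less_imp_le])
    then show ?thesis using Y1 unfolding Y_def by blast
  qed
  obtain n where "integrable M (\<lambda>\<omega>. X \<omega> - S n \<omega>)" using ev[of 1] by auto
  from Bochner_Integration.integrable_add[OF this S(1)[of n]] show X1: "integrable M X" by simp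
  have "\<bar>expectation X\<bar> \<le> 0 + e" if e: "e > 0" for e
    using ev[OF e] X1 S by (auto simp: Bochner_Integration.integral_diff)
  then have "\<bar>expectation X\<bar> \<le> 0" by (rule field_le_epsilon)
  then show "expectation X = 0" by simp
qed

text \<open>
  The spatial mean of the partial sums is a linear combination of Brownian motions, hence of mean
  zero, and \<open>\<bar>\<integral> f\<bar> \<le> sqrt L * H1norm L f\<close> carries the convergence of the series over to the spatial
  means.
\<close>

lemma wiener_integral_mean_zero:
  fixes \<Phi> :: "(real \<Rightarrow> real) \<Rightarrow> real \<Rightarrow> real"
  assumes L: "L > 0" and t: "t \<ge> 0" and F: "filtered_prob_space M F"
    and b: "\<And>i. brownian_motion M F (b i)" and e: "\<And>i. e i \<in> L2 L"
    and \<Phi>: "\<And>f. f \<in> L2 L \<Longrightarrow> \<Phi> f \<in> H1 L"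
    and Z: "wiener_integral M L b e \<Phi> t Z"
  shows "integrable M (\<lambda>\<omega>. integral\<^sup>L (domain_measure L) (Z \<omega>))"
    and "(\<integral>\<omega>. integral\<^sup>L (domain_measure L) (Z \<omega>) \<partial>M) = 0"
proof -
  let ?D = "domain_measure L"
  interpret prob_space M using F by (simp add: filtered_prob_space_def)
  \<comment> \<open>Dividing by \<open>sqrt L\<close> gives the bound by the $H^1$ norm the constant $1$: the integrand in the
    convergence hypothesis is only known through its (lower) integral, out of which no constant is
    pulled without measurability.\<close>
  define X where "X \<omega> = integral\<^sup>L ?D (Z \<omega>) / sqrt L" for \<omega>
  define c where "c i = integral\<^sup>L ?D (\<Phi> (e i)) / sqrt L" for i
  define S where "S n \<omega> = (\<Sum>i<n. b i t \<omega> * c i)" for n \<omega>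
  have Zm: "Z \<in> measurable M (H1_borel L)"
    and Zl: "(\<lambda>n. \<integral>\<^sup>+\<omega>. ennreal ((H1norm L (\<lambda>x. Z \<omega> x - (\<Sum>i<n. b i t \<omega> *\<^sub>R \<Phi> (e i) x)))\<^sup>2) \<partial>M) \<longlonglongrightarrow> 0"
    using Z by (auto simp: wiener_integral_def)
  have X: "X \<in> borel_measurable M"
    unfolding X_def[abs_def]
    by (intro borel_measurable_divide borel_measurable_const measurable_compose[OF Zm integral_H1_borel_measurable[OF L]])
  note bt = brownian_motion_mean_zero[OF F b t]
  have S1: "integrable M (S n)" for n
    unfolding S_def[abs_def] by (intro Bochner_Integration.integrable_sum integrable_mult_left bt)
  have S2: "expectation (S n) = 0" for n
    unfolding S_def[abs_def] using bt
    by (subst Bochner_Integration.integral_sum) auto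
  have pw: "(X \<omega> - S n \<omega>)\<^sup>2 \<le>
      (H1norm L (\<lambda>x. Z \<omega> x - (\<Sum>i<n. b i t \<omega> *\<^sub>R \<Phi> (e i) x)))\<^sup>2" if \<omega>: "\<omega> \<in> space M" for \<omega> n
  proof -
    have Z2: "Z \<omega> \<in> L2 L" by (rule H1_L2[OF measurable_H1_borel_in_H1[OF Zm \<omega>]])
    have P2: "(\<lambda>x. b i t \<omega> * \<Phi> (e i) x) \<in> L2 L" for i by (intro L2_scale H1_L2 \<Phi> e)
    have "integral\<^sup>L ?D (\<lambda>x. \<Sum>i<n. b i t \<omega> * \<Phi> (e i) x) / sqrt L = S n \<omega>"
      unfolding S_def c_def
      by (subst Bochner_Integration.integral_sum[OF L2_integrable[OF P2]]) (simp add: sum_divide_distrib)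
    then have "X \<omega> - S n \<omega> = integral\<^sup>L ?D (\<lambda>x. Z \<omega> x - (\<Sum>i<n. b i t \<omega> * \<Phi> (e i) x)) / sqrt L"
      unfolding X_def
      by (subst Bochner_Integration.integral_diff)
        (auto intro!: L2_integrable Z2 L2_sum P2 simp: diff_divide_distrib)
    moreover have "\<bar>integral\<^sup>L ?D (\<lambda>x. Z \<omega> x - (\<Sum>i<n. b i t \<omega> * \<Phi> (e i) x))\<bar> \<le>
        sqrt L * H1norm L (\<lambda>x. Z \<omega> x - (\<Sum>i<n. b i t \<omega> * \<Phi> (e i) x))"
      by (intro abs_integral_le_H1norm L L2_diff L2_sum Z2 P2)
    ultimately have "\<bar>X \<omega> - S n \<omega>\<bar> \<le> H1norm L (\<lambda>x. Z \<omega> x - (\<Sum>i<n. b i t \<omega> * \<Phi> (e i) x))"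
      using L by (simp add: abs_divide pos_divide_le_eq mult.commute[of _ "sqrt L"])
    then have "\<bar>X \<omega> - S n \<omega>\<bar>\<^sup>2 \<le> (H1norm L (\<lambda>x. Z \<omega> x - (\<Sum>i<n. b i t \<omega> * \<Phi> (e i) x)))\<^sup>2"
      by (rule power_mono) simp
    then show ?thesis by simp
  qed
  have "(\<lambda>n. \<integral>\<^sup>+\<omega>. ennreal ((X \<omega> - S n \<omega>)\<^sup>2) \<partial>M) \<longlonglongrightarrow> 0"
  proof (rule tendsto_sandwich[OF _ _ tendsto_const Zl])
    show "\<forall>\<^sub>F n in sequentially. (\<integral>\<^sup>+\<omega>. ennreal ((X \<omega> - S n \<omega>)\<^sup>2) \<partial>M) \<le>
      (\<integral>\<^sup>+\<omega>. ennreal ((H1norm L (\<lambda>x. Z \<omega> x - (\<Sum>i<n. b i t \<omega> *\<^sub>R \<Phi> (e i) x)))\<^sup>2) \<partial>M)"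
      by (intro always_eventually allI nn_integral_mono ennreal_leI pw)
  qed simp
  from expectation_zero_L2_limit[OF X S1 S2 this]
  have "integrable M (\<lambda>\<omega>. X \<omega> * sqrt L)" "expectation (\<lambda>\<omega>. X \<omega> * sqrt L) = 0" by auto
  moreover have "X \<omega> * sqrt L = integral\<^sup>L ?D (Z \<omega>)" for \<omega> using L by (simp add: X_def)
  ultimately show "integrable M (\<lambda>\<omega>. integral\<^sup>L ?D (Z \<omega>))" "(\<integral>\<omega>. integral\<^sup>L ?D (Z \<omega>) \<partial>M) = 0"
    by simp_all
qed

theorem mainTheorem1:
  fixes M :: "'w measure" and F :: "real \<Rightarrow> 'w measure"
    and L T \<gamma>1 \<gamma>2 \<beta> :: real
    and b1 b2 :: "nat \<Rightarrow> real \<Rightarrow> 'w \<Rightarrow> real" and e1 e2 :: "nat \<Rightarrow> real \<Rightarrow> real"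
    and \<Phi>1 :: "(real \<Rightarrow> real) \<Rightarrow> real \<Rightarrow> complex" and \<Phi>2 :: "(real \<Rightarrow> real) \<Rightarrow> real \<Rightarrow> real"
    and u0 :: "real \<Rightarrow> complex" and v0 :: "real \<Rightarrow> real"
    and u :: "real \<Rightarrow> 'w \<Rightarrow> real \<Rightarrow> complex" and v :: "real \<Rightarrow> 'w \<Rightarrow> real \<Rightarrow> real"
  assumes "L > 0" and "T > 0" and "\<gamma>1 * \<gamma>2 > 0"
    and "filtered_prob_space M F"
    and "independent_cylindrical_wiener M F L b1 e1 b2 e2"
    and "u0 \<in> H1 L" and "v0 \<in> H1 L"
    and "hilbert_schmidt L \<Phi>1" and "hilbert_schmidt L \<Phi>2"
    and "skdv_solution M F L T \<gamma>1 \<gamma>2 \<beta> b1 e1 b2 e2 \<Phi>1 \<Phi>2 u0 v0 u v"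
  shows "\<forall>t\<in>{0..T}.
    prob_space.expectation M (\<lambda>\<omega>. LINT x:{0<..<L}|lborel. v t \<omega> x) =
    prob_space.expectation M (\<lambda>\<omega>. LINT x:{0<..<L}|lborel. v0 x)"
proof
  fix t assume t: "t \<in> {0..T}"
  let ?D = "domain_measure L"
  have F: "filtered_prob_space M F" by fact
  interpret prob_space M using F by (simp add: filtered_prob_space_def)
  have sol: "continuous_adapted_H1 M F L T v"
    "\<exists>Z. wiener_integral M L b2 e2 \<Phi>2 t Z \<and>
        (AE \<omega> in M. \<forall>\<phi>\<in>test_functions L.
           regular_distribution L (v t \<omega>) \<phi> =
             regular_distribution L v0 \<phi>
             + (LINT s:{0..t}|lborel. kdv_drift L \<gamma>2 (u s \<omega>) (v s \<omega>) \<phi>)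
             + regular_distribution L (Z \<omega>) \<phi>)"
    using assms(10) t unfolding skdv_solution_def by blast+
  then obtain Z where Z: "wiener_integral M L b2 e2 \<Phi>2 t Z"
    and eq: "AE \<omega> in M. \<forall>\<phi>\<in>test_functions L.
           regular_distribution L (v t \<omega>) \<phi> =
             regular_distribution L v0 \<phi>
             + (LINT s:{0..t}|lborel. kdv_drift L \<gamma>2 (u s \<omega>) (v s \<omega>) \<phi>)
             + regular_distribution L (Z \<omega>) \<phi>"
    by blast
  have vm: "v s \<in> measurable M (H1_borel L)" if "s \<in> {0..T}" for s
    using sol(1) F that unfolding continuous_adapted_H1_def filtered_prob_space_def
    by (meson measurable_from_subalg)
  have noise: "integrable M (\<lambda>\<omega>. integral\<^sup>L ?D (Z \<omega>))" "expectation (\<lambda>\<omega>. integral\<^sup>L ?D (Z \<omega>)) = 0"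
  proof -
    have "\<And>i. brownian_motion M F (b2 i)" "\<And>i. e2 i \<in> L2 L"
      using assms(5) by (auto simp: independent_cylindrical_wiener_def orthonormal_basis_def)
    moreover have "\<And>f. f \<in> L2 L \<Longrightarrow> \<Phi>2 f \<in> H1 L"
      using assms(9) by (simp add: hilbert_schmidt_def)
    ultimately show "integrable M (\<lambda>\<omega>. integral\<^sup>L ?D (Z \<omega>))" "expectation (\<lambda>\<omega>. integral\<^sup>L ?D (Z \<omega>)) = 0"
      using wiener_integral_mean_zero[OF assms(1) _ F _ _ _ Z] t by auto
  qed
  \<comment> \<open>The equation tested against the constant $1$: the drift vanishes at every time, not only almost
    everywhere, because every value of the process lies in $H^1$.\<close>
  have "AE \<omega> in M. integral\<^sup>L ?D (v t \<omega>) = integral\<^sup>L ?D v0 + integral\<^sup>L ?D (Z \<omega>)"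
    using eq AE_space
  proof eventually_elim
    case (elim \<omega>)
    have "kdv_drift L \<gamma>2 (u s \<omega>) (v s \<omega>) (\<lambda>_. 1) = 0" if "s \<in> {0..t}" for s
      using that t by (intro kdv_drift_const_zero assms(1) measurable_H1_borel_in_H1[OF vm elim(2)]) auto
    then have "(LINT s:{0..t}|lborel. kdv_drift L \<gamma>2 (u s \<omega>) (v s \<omega>) (\<lambda>_. 1)) = (LINT s:{0..t}|lborel. 0)"
      by (intro set_lebesgue_integral_cong) auto
    then show ?case
      using elim(1)[rule_format, OF const_test_function[of 1]] by (simp add: regular_distribution_def)
  qed
  then have "expectation (\<lambda>\<omega>. integral\<^sup>L ?D (v t \<omega>)) =
      expectation (\<lambda>\<omega>. integral\<^sup>L ?D v0 + integral\<^sup>L ?D (Z \<omega>))"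
  proof (rule integral_cong_AE[rotated 2])
    show "(\<lambda>\<omega>. integral\<^sup>L ?D (v t \<omega>)) \<in> borel_measurable M"
      by (rule measurable_compose[OF vm[OF t] integral_H1_borel_measurable[OF assms(1)]])
    show "(\<lambda>\<omega>. integral\<^sup>L ?D v0 + integral\<^sup>L ?D (Z \<omega>)) \<in> borel_measurable M"
      using noise(1) by simp
  qed
  also have "\<dots> = expectation (\<lambda>\<omega>. integral\<^sup>L ?D v0)"
    using noise by simp
  finally show "expectation (\<lambda>\<omega>. LINT x:{0<..<L}|lborel. v t \<omega> x) =
      expectation (\<lambda>\<omega>. LINT x:{0<..<L}|lborel. v0 x)"
    unfolding integral_domain_measure .
qed

end
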